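(* Let $f\ge 1$, let $\mathbb{F}=\mathbb{F}_{2^f}$, and let $C\le \mathbb{F}^n$ be a doubly-even self-dual code. Then the complete weight enumerator $\operatorname{cwe}(C)$ lies in the invariant ring $$\operatorname{Inv}(G_f)=\{p\in\mathbb{C}[x_a\mid a\in\mathbb{F}] \mid p \text{ is fixed by every } g\in G_f\},$$ where $G_f$ is the Clifford-Weil group.
   Context: Let $\mathbb{F}=\mathbb{F}_{2^f}$. A code $C\le\mathbb{F}^n$ is an $\mathbb{F}$-linear subspace. Its dual is $C^\perp=\{v\in\mathbb{F}^n\mid \sum_{i=1}^n c_iv_i=0 \text{ for all } c\in C\}$; $C$ is self-dual if $C=C^\perp$. $C$ is doubly-even if $\sum_{i=1}^n c_i=0$ and $\sum_{i<j}c_ic_j=0$ for all $c\in C$. The complete weight enumerator of $C$ is $\operatorname{cwe}(C)=\sum_{c\in C}\prod_{i=1}^n x_{c_i}\in\mathbb{C}[x_a\mid a\in\mathbb{F}]$. Let $\tau:\mathbb{F}\to\mathbb{F}_2$ be the trace. Fix a self-complementary (trace-orthogonal) basis of $\mathbb{F}$, i.e. an $\mathbb{F}_2$-basis $(b_1,\dots,b_f)$ with $\tau(b_ib_j)=\delta_{ij}$ for all $i,j$. Define $\varphi:\mathbb{F}\to\mathbb{Z}/4\mathbb{Z}$ by $\varphi(\sum_{i=1}^f a_ib_i)=\operatorname{wt}(a_1,\dots,a_f)+4\mathbb{Z}$ ($a_i\in\mathbb{F}_2$), where $\operatorname{wt}$ is the number of nonzero entries. Let $m_r$, $d_r$ (for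 $0\ne r\in\mathbb{F}$) and $h$ be the $\mathbb{C}$-algebra endomorphisms of $\mathbb{C}[x_a\mid a\in\mathbb{F}]$ given, for all $a\in\mathbb{F}$, by $$m_r(x_a)=x_{ar},\qquad d_r(x_a)=i^{\varphi(ar)}x_a,\qquad h(x_a)=2^{-f/2}\sum_{b\in\mathbb{F}}(-1)^{\tau(ab)}x_b,$$ where $i=\sqrt{-1}$. The Clifford-Weil group is $G_f=\langle h,m_r,d_r\mid 0\ne r\in\mathbb{F}\rangle$. *)

theory Defs
  imports
    Complex_Main
    "HOL-Library.Cardinality"
    "HOL-Library.Z2"
    "HOL-Library.Poly_Mapping"
    "HOL-Algebra.Bij"
    "HOL-Algebra.Generated_Groups"
    "HOL-Computational_Algebra.Primes"
    "HOL-Number_Theory.Residues"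
    "Jordan_Normal_Form.VS_Connect"
begin

section \<open>The field with $2^f$ elements over its prime field\<close>

text \<open>The field is a type \<open>'a\<close> of class \<^class>\<open>finite_field\<close> with \<open>CARD('a) = 2 ^ f\<close>; its prime
  field is the type \<^typ>\<open>bit\<close>, embedded by \<^term>\<open>of_bit\<close>.\<close>

definition F2_scale :: "bit \<Rightarrow> 'a::finite_field \<Rightarrow> 'a" where
  "F2_scale c x = of_bit c * x"

text \<open>The sum of the Frobenius conjugates lies in the prime field, i.e. it is 0 or 1; see
  \<open>of_bit_trace\<close> below.\<close>

definition field_trace :: "nat \<Rightarrow> 'a::finite_field \<Rightarrow> bit" where
  "field_trace f x = (if (\<Sum>k<f. x ^ (2 ^ k)) = 0 then 0 else 1)"

definition F2_basis :: "nat \<Rightarrow> (nat \<Rightarrow> 'a::finite_field) \<Rightarrow> bool" where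
  "F2_basis f b \<longleftrightarrow> inj_on b {..<f}
     \<and> \<not> Modules.module.dependent F2_scale (b ` {..<f})
     \<and> Modules.module.span F2_scale (b ` {..<f}) = UNIV"

definition self_complementary_basis :: "nat \<Rightarrow> (nat \<Rightarrow> 'a::finite_field) \<Rightarrow> bool" where
  "self_complementary_basis f b \<longleftrightarrow> F2_basis f b
     \<and> (\<forall>i<f. \<forall>j<f. field_trace f (b i * b j) = (if i = j then 1 else 0))"

text \<open>An element of $\mathbf{Z}/4\mathbf{Z}$ is represented by its residue in \<open>{0..<4}\<close>.\<close>

definition phi :: "nat \<Rightarrow> (nat \<Rightarrow> 'a::finite_field) \<Rightarrow> 'a \<Rightarrow> nat" where
  "phi f b x = card {i. i < f \<and> Modules.module.representation F2_scale (b ` {..<f}) x (b i) \<noteq> 0} mod 4"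

lemma CHAR_eq_2:
  assumes "card (UNIV :: 'a::finite_field set) = 2 ^ f"
  shows "CHAR('a) = 2"
proof -
  have "CHAR('a) dvd 2 ^ f" using CHAR_dvd_CARD[where 'a='a] assms by simp
  moreover have "prime CHAR('a)" by simp
  ultimately show ?thesis
    by (meson prime_dvd_power primes_dvd_imp_eq two_is_prime_nat)
qed

lemma vector_space_F2_scale:
  assumes "card (UNIV :: 'a::finite_field set) = 2 ^ f"
  shows "vector_space (F2_scale :: bit \<Rightarrow> 'a \<Rightarrow> 'a)"
proof -
  have "of_nat 2 = (0::'a)"
    by (simp only: of_nat_eq_0_iff_char_dvd CHAR_eq_2[OF assms]) simp
  then have two: "1 + 1 = (0::'a)" by simp
  have *: "x + x = 0" for x :: 'a
    using two by (metis distrib_left mult.right_neutral mult_zero_right)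
  show ?thesis
  proof (unfold_locales, goal_cases)
    case (2 a b x)
    then show ?case by (cases a; cases b) (simp_all add: F2_scale_def *)
  next
    case (3 a b x)
    then show ?case by (cases a; cases b) (simp_all add: F2_scale_def)
  qed (simp_all add: F2_scale_def distrib_left)
qed

lemma of_bit_trace:
  fixes x :: "'a::finite_field"
  assumes card: "CARD('a) = 2 ^ f"
  shows "of_bit (field_trace f x) = (\<Sum>k<f. x ^ (2 ^ k))"
proof -
  let ?s = "\<Sum>k<f. x ^ (2 ^ k)"
  have "?s ^ 2 = (\<Sum>k<f. (x ^ (2 ^ k)) ^ 2)"
    by (rule freshmans_dream_sum) (use CHAR_eq_2[OF card] in auto)
  also have "\<dots> = (\<Sum>k<f. x ^ (2 ^ Suc k))"
    by (simp only: power_mult[symmetric] power_Suc2)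
  finally have "?s ^ 2 + x = (\<Sum>k<Suc f. x ^ (2 ^ k))"
    by (subst sum.lessThan_Suc_shift) simp
  also have "\<dots> = ?s + x"
    using finite_field_power_card_eq_same[of x] card by simp
  finally have "?s * ?s = ?s * 1" by (simp add: power2_eq_square)
  then have "?s = 0 \<or> ?s = 1" by (simp only: mult_cancel_left)
  then show ?thesis by (auto simp: field_trace_def)
qed

lemma phi_sum:
  fixes b :: "nat \<Rightarrow> 'a::finite_field"
  assumes card: "CARD('a) = 2 ^ f" and b: "F2_basis f b"
  shows "phi f b (\<Sum>i<f. F2_scale (a i) (b i)) = card {i. i < f \<and> a i \<noteq> 0} mod 4"
proof -
  interpret vector_space "F2_scale :: bit \<Rightarrow> 'a \<Rightarrow> 'a"
    by (rule vector_space_F2_scale[OF card])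
  from b have inj: "inj_on b {..<f}" and ind: "independent (b ` {..<f})"
    and sp: "span (b ` {..<f}) = UNIV"
    by (auto simp: F2_basis_def)
  let ?x = "\<Sum>i<f. F2_scale (a i) (b i)"
  let ?g = "\<lambda>v. if v \<in> b ` {..<f} then a (the_inv_into {..<f} b v) else 0"
  have g: "?g (b i) = a i" if "i < f" for i
    using that inj by (simp add: the_inv_into_f_f)
  have "representation (b ` {..<f}) ?x = ?g"
  proof (rule representation_eqI[OF ind])
    show "?x \<in> span (b ` {..<f})" using sp by simp
    show "finite {v. ?g v \<noteq> 0}" by simp
    have "(\<Sum>v | ?g v \<noteq> 0. F2_scale (?g v) v) = (\<Sum>v\<in>b ` {..<f}. F2_scale (?g v) v)"
      by (rule sum.mono_neutral_left) (auto split: if_splits)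
    also have "\<dots> = (\<Sum>i<f. F2_scale (?g (b i)) (b i))"
      using inj by (simp add: sum.reindex)
    also have "\<dots> = ?x" using g by (intro sum.cong) auto
    finally show "(\<Sum>v | ?g v \<noteq> 0. F2_scale (?g v) v) = ?x" .
  qed (auto split: if_splits)
  then have "representation (b ` {..<f}) ?x (b i) = a i" if "i < f" for i
    using g[OF that] by simp
  then show ?thesis unfolding phi_def by (metis (mono_tags, lifting))
qed


section \<open>Codes\<close>

definition linear_code :: "nat \<Rightarrow> 'a::finite_field vec set \<Rightarrow> bool" where
  "linear_code n C \<longleftrightarrow> VectorSpace.subspace class_ring C (module_vec TYPE('a) n)"

definition dual_code :: "nat \<Rightarrow> 'a::finite_field vec set \<Rightarrow> 'a vec set" where
  "dual_code n C = {v \<in> carrier_vec n. \<forall>c\<in>C. c \<bullet> v = 0}"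

definition self_dual :: "nat \<Rightarrow> 'a::finite_field vec set \<Rightarrow> bool" where
  "self_dual n C \<longleftrightarrow> C = dual_code n C"

definition doubly_even :: "nat \<Rightarrow> 'a::finite_field vec set \<Rightarrow> bool" where
  "doubly_even n C \<longleftrightarrow>
     (\<forall>c\<in>C. (\<Sum>i<n. c $ i) = 0 \<and> (\<Sum>j<n. \<Sum>i<j. c $ i * c $ j) = 0)"


section \<open>Complex polynomials in variables indexed by the field\<close>

text \<open>A monomial is its exponent function \<open>'a \<Rightarrow>\<^sub>0 nat\<close>, a polynomial the finitely supported
  function of its coefficients.\<close>

type_synonym 'a cpoly = "('a \<Rightarrow>\<^sub>0 nat) \<Rightarrow>\<^sub>0 complex"

definition Const :: "complex \<Rightarrow> 'a cpoly" where
  "Const c = Poly_Mapping.single 0 c"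

definition X :: "'a \<Rightarrow> 'a cpoly" where
  "X a = Poly_Mapping.single (Poly_Mapping.single a 1) 1"

text \<open>Substitution of \<open>s a\<close> for \<open>X a\<close>; the lemmas below show that it is the unital algebra
  endomorphism determined by these values.\<close>

definition alg_endo :: "('a::finite \<Rightarrow> 'a cpoly) \<Rightarrow> 'a cpoly \<Rightarrow> 'a cpoly" where
  "alg_endo s p = (\<Sum>m\<in>Poly_Mapping.keys p.
     Const (Poly_Mapping.lookup p m) * (\<Prod>a\<in>UNIV. s a ^ Poly_Mapping.lookup m a))"

lemma alg_endo_superset:
  assumes "finite A" "Poly_Mapping.keys p \<subseteq> A"
  shows "alg_endo s p = (\<Sum>m\<in>A.
     Const (Poly_Mapping.lookup p m) * (\<Prod>a\<in>UNIV. s a ^ Poly_Mapping.lookup m a))"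
  unfolding alg_endo_def
  by (rule sum.mono_neutral_left) (use assms in \<open>auto simp: Const_def in_keys_iff\<close>)

lemma alg_endo_add: "alg_endo s (p + q) = alg_endo s p + alg_endo s q"
proof -
  let ?A = "Poly_Mapping.keys p \<union> Poly_Mapping.keys q"
  have "Poly_Mapping.keys (p + q) \<subseteq> ?A" by (rule keys_add)
  then show ?thesis
    by (simp add: alg_endo_superset[of ?A] lookup_add Const_def single_add distrib_right
        sum.distrib)
qed

lemma alg_endo_zero: "alg_endo s 0 = 0"
  by (simp add: alg_endo_def)

lemma alg_endo_sum: "alg_endo s (sum g A) = (\<Sum>i\<in>A. alg_endo s (g i))"
  by (induction A rule: infinite_finite_induct) (simp_all add: alg_endo_zero alg_endo_add)

lemma alg_endo_single:
  "alg_endo s (Poly_Mapping.single m c) =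
     Const c * (\<Prod>a\<in>UNIV. s a ^ Poly_Mapping.lookup m a)"
  by (cases "c = 0") (simp_all add: alg_endo_def Const_def)

lemma poly_mapping_eq_sum_single:
  "p = (\<Sum>m\<in>Poly_Mapping.keys p. Poly_Mapping.single m (Poly_Mapping.lookup p m))"
  by (rule poly_mapping_eqI)
    (auto simp: lookup_sum lookup_single when_def in_keys_iff sum.delta)

lemma alg_endo_mult: "alg_endo s (p * q) = alg_endo s p * alg_endo s q"
proof -
  let ?S = "\<lambda>p m. Poly_Mapping.single m (Poly_Mapping.lookup p m)"
  have single: "alg_endo s (Poly_Mapping.single m c * Poly_Mapping.single m' c') =
      alg_endo s (Poly_Mapping.single m c) * alg_endo s (Poly_Mapping.single m' c')"
    for m m' :: "'a \<Rightarrow>\<^sub>0 nat" and c c' :: complex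
  proof -
    have "Const (c * c') = Const c * (Const c' :: 'a cpoly)"
      by (simp add: Const_def mult_single)
    then show ?thesis
      by (simp add: mult_single alg_endo_single lookup_add power_add prod.distrib mult_ac)
  qed
  have "p * q = (\<Sum>m\<in>Poly_Mapping.keys p. \<Sum>m'\<in>Poly_Mapping.keys q. ?S p m * ?S q m')"
    by (subst (1) poly_mapping_eq_sum_single[of p], subst (1) poly_mapping_eq_sum_single[of q])
      (rule sum_product)
  then have "alg_endo s (p * q) =
      (\<Sum>m\<in>Poly_Mapping.keys p. \<Sum>m'\<in>Poly_Mapping.keys q.
         alg_endo s (?S p m) * alg_endo s (?S q m'))"
    by (simp add: alg_endo_sum single)
  also have "\<dots> = (\<Sum>m\<in>Poly_Mapping.keys p. alg_endo s (?S p m)) *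
      (\<Sum>m'\<in>Poly_Mapping.keys q. alg_endo s (?S q m'))"
    by (rule sum_product[symmetric])
  also have "\<dots> = alg_endo s p * alg_endo s q"
    by (simp flip: alg_endo_sum poly_mapping_eq_sum_single)
  finally show ?thesis .
qed

lemma alg_endo_Const: "alg_endo s (Const c) = Const c"
  unfolding Const_def[of c] alg_endo_single by (simp add: Const_def)

lemma alg_endo_X: "alg_endo s (X a) = s a"
proof -
  have "(\<Prod>b\<in>UNIV. s b ^ Poly_Mapping.lookup (Poly_Mapping.single a 1) b) = s a"
    by (subst prod.remove[of _ a]) (auto simp: lookup_single when_def intro!: prod.neutral)
  then show ?thesis
    by (simp add: X_def alg_endo_single) (simp add: Const_def)
qed

definition cwe :: "nat \<Rightarrow> 'a::finite_field vec set \<Rightarrow> 'a cpoly" where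
  "cwe n C = (\<Sum>c\<in>C. \<Prod>i<n. X (c $ i))"


section \<open>The Clifford-Weil group\<close>

definition m_op :: "'a::finite_field \<Rightarrow> 'a cpoly \<Rightarrow> 'a cpoly" where
  "m_op r = alg_endo (\<lambda>a. X (a * r))"

definition d_op :: "nat \<Rightarrow> (nat \<Rightarrow> 'a::finite_field) \<Rightarrow> 'a \<Rightarrow> 'a cpoly \<Rightarrow> 'a cpoly" where
  "d_op f b r = alg_endo (\<lambda>a. Const (\<i> ^ phi f b (a * r)) * X a)"

definition h_op :: "nat \<Rightarrow> 'a::finite_field cpoly \<Rightarrow> 'a cpoly" where
  "h_op f = alg_endo (\<lambda>a. Const (complex_of_real (2 powr (- real f / 2))) *
     (\<Sum>b\<in>UNIV. Const (if field_trace f (a * b) = 0 then 1 else -1) * X b))"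

text \<open>The subgroup generated inside the group of all bijections of the polynomial ring.\<close>

definition clifford_weil :: "nat \<Rightarrow> (nat \<Rightarrow> 'a::finite_field) \<Rightarrow> ('a cpoly \<Rightarrow> 'a cpoly) set" where
  "clifford_weil f b = generate (BijGroup UNIV)
     ({h_op f} \<union> {m_op r | r. r \<noteq> 0} \<union> {d_op f b r | r. r \<noteq> 0})"

definition Inv :: "('a cpoly \<Rightarrow> 'a cpoly) set \<Rightarrow> 'a cpoly set" where
  "Inv G = {p. \<forall>g\<in>G. g p = p}"

end

theory Submission
  imports Defs
begin

text \<open>Let $\psi(x) = (-1)^{\tau(x)}$ and $\chi(x) = i^{\varphi(x)}$. Since the basis is
  trace-orthogonal, $\chi(x + y) = \chi(x)\chi(y)\psi(xy)$, hence
  $\prod_i \chi(c_i)\cdot\psi(\sum_{i<j} c_i c_j) = \chi(\sum_i c_i)$, and doubly-evenness makes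
  $\prod_i \chi(c_i) = 1$ on the code; this gives invariance under \<open>d\<^sub>r\<close>. Invariance under \<open>m\<^sub>r\<close> is
  reindexing, and invariance under \<open>h\<close> is the MacWilliams identity together with
  $|C|\,|C^\perp| = 2^{fn}$. All generators are invertible, so the fixed points of the generators
  are fixed by the group they generate.\<close>

section \<open>Algebra endomorphisms of the polynomial ring\<close>

lemma Const_mult: "Const (x * y) = Const x * Const y"
  by (simp add: Const_def mult_single)

lemma Const_add: "Const (x + y) = Const x + Const y"
  by (simp add: Const_def single_add)

lemma Const_0 [simp]: "Const 0 = 0"
  by (simp add: Const_def)

lemma Const_1 [simp]: "Const 1 = 1"
  by (simp add: Const_def)

lemma Const_sum: "Const (sum g A) = (\<Sum>i\<in>A. Const (g i))"
  by (induction A rule: infinite_finite_induct) (simp_all add: Const_add)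

lemma Const_prod: "Const (prod g A) = (\<Prod>i\<in>A. Const (g i))"
  by (induction A rule: infinite_finite_induct) (simp_all add: Const_mult)

lemma alg_endo_1: "alg_endo s 1 = 1"
  using alg_endo_Const[of s 1] by simp

lemma alg_endo_prod: "alg_endo s (prod g A) = (\<Prod>i\<in>A. alg_endo s (g i))"
  by (induction A rule: infinite_finite_induct) (simp_all add: alg_endo_1 alg_endo_mult)

lemma alg_endo_power: "alg_endo s (p ^ k) = alg_endo s p ^ k"
  by (induction k) (simp_all add: alg_endo_1 alg_endo_mult)

text \<open>The outer substitution commutes with the sums, products, powers and constants from which
  the inner one is built. Composites can therefore be compared on the variables alone.\<close>

lemma alg_endo_alg_endo: "alg_endo s (alg_endo t p) = alg_endo (\<lambda>a. alg_endo s (t a)) p"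
  unfolding alg_endo_def[of t] alg_endo_def[of "\<lambda>a. alg_endo s (t a)"]
  by (simp only: alg_endo_sum alg_endo_mult alg_endo_Const alg_endo_prod alg_endo_power)

lemma X_power: "X a ^ k = Poly_Mapping.single (Poly_Mapping.single a k) 1"
  by (induction k) (simp_all add: X_def mult_single flip: single_add)

lemma prod_single_1:
  "(\<Prod>a\<in>A. Poly_Mapping.single (g a) (1::complex)) = Poly_Mapping.single (\<Sum>a\<in>A. g a) 1"
  by (induction A rule: infinite_finite_induct) (simp_all add: mult_single)

lemma alg_endo_X_id: "alg_endo X p = (p :: 'a::finite cpoly)"
proof -
  have sum_single: "(\<Sum>a\<in>UNIV. Poly_Mapping.single a (Poly_Mapping.lookup m a)) = m"
    for m :: "'a \<Rightarrow>\<^sub>0 nat"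
    by (rule poly_mapping_eqI) (simp add: lookup_sum lookup_single when_def)
  have "alg_endo X p =
      (\<Sum>m\<in>Poly_Mapping.keys p. Poly_Mapping.single m (Poly_Mapping.lookup p m))"
    unfolding alg_endo_def
    by (simp add: X_power prod_single_1 sum_single Const_def mult_single)
  then show ?thesis using poly_mapping_eq_sum_single[of p] by simp
qed

text \<open>A composite of substitutions is a substitution, and the one fixing every variable is the
  identity. All generators are shown invertible this way.\<close>

lemma alg_endo_inverse:
  assumes "\<And>a. alg_endo s (t a) = X a"
  shows "alg_endo s (alg_endo t p) = p"
  using assms by (simp add: alg_endo_alg_endo alg_endo_X_id)

lemma alg_endo_cwe: "alg_endo s (cwe n C) = (\<Sum>c\<in>C. \<Prod>i<n. s (c $ i))"
  by (simp add: cwe_def alg_endo_sum alg_endo_prod alg_endo_X)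

section \<open>Fixed points of a generated group of bijections\<close>

text \<open>Bijectivity puts the generators into the carrier, where the group inverse is the inverse
  function and the product is composition; both preserve a common fixed point.\<close>

lemma generate_BijGroup_fixed:
  assumes bij: "\<And>g. g \<in> S \<Longrightarrow> bij g" and fixed: "\<And>g. g \<in> S \<Longrightarrow> g x = x"
    and g: "g \<in> generate (BijGroup UNIV) S"
  shows "g x = x"
proof -
  interpret group "BijGroup (UNIV :: 'a set)" by (rule group_BijGroup)
  have carr: "h \<in> carrier (BijGroup UNIV)" if "h \<in> S" for h
    using bij[OF that] by (simp add: BijGroup_def Bij_def)
  show ?thesis using g
  proof (induction rule: generate.induct)
    case one
    then show ?case by (simp add: BijGroup_def)
  next
    case (incl h)
    then show ?case by (rule fixed)
  next
    case (inv h)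
    have "h \<in> Bij UNIV" using carr[OF inv] by (simp add: BijGroup_def)
    then have "inv\<^bsub>BijGroup UNIV\<^esub> h = inv_into UNIV h"
      by (subst inv_BijGroup) auto
    then show ?case using fixed[OF inv] bij[OF inv]
      by (metis bij_is_inj inv_f_f)
  next
    case (eng h1 h2)
    have "generate (BijGroup UNIV) S \<subseteq> carrier (BijGroup UNIV)"
      by (rule generate_incl) (use carr in auto)
    then have "h1 \<in> Bij UNIV" "h2 \<in> Bij UNIV"
      using eng.hyps by (auto simp: BijGroup_def)
    then show ?case using eng.IH by (simp add: BijGroup_def compose_def)
  qed
qed

text \<open>By default the simplifier rewrites sums and products in \<^typ>\<open>bit\<close> to bitwise operations.\<close>

declare add_bit_eq_xor [simp del] mult_bit_eq_and [simp del]

section \<open>The trace character and the quadratic character\<close>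

lemma double_eq_0:
  assumes "CARD('a::finite_field) = 2 ^ f"
  shows "x + x = (0::'a)"
proof -
  have "of_nat 2 = (0::'a)"
    by (simp only: of_nat_eq_0_iff_char_dvd CHAR_eq_2[OF assms]) simp
  then have "(1::'a) + 1 = 0" by simp
  then show ?thesis by (metis distrib_left mult.right_neutral mult_zero_right)
qed

lemma of_bit_add:
  assumes "CARD('a::finite_field) = 2 ^ f"
  shows "of_bit (c + d) = (of_bit c + of_bit d :: 'a)"
  by (cases c; cases d) (simp_all add: double_eq_0[OF assms])

lemma of_bit_inject: "(of_bit c :: 'a::finite_field) = of_bit d \<longleftrightarrow> c = d"
  by (cases c; cases d) simp_all

text \<open>Frobenius powers are additive in characteristic 2. The comparison is made inside the
  field and pulled back along the injective embedding \<open>of_bit\<close>.\<close>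

lemma field_trace_add:
  fixes x y :: "'a::finite_field"
  assumes card: "CARD('a) = 2 ^ f"
  shows "field_trace f (x + y) = field_trace f x + field_trace f y"
proof -
  have "(x + y) ^ (2 ^ k) = x ^ (2 ^ k) + y ^ (2 ^ k)" for k
    by (rule freshmans_dream') (simp_all add: CHAR_eq_2[OF card])
  then have "of_bit (field_trace f (x + y)) =
      (of_bit (field_trace f x) + of_bit (field_trace f y) :: 'a)"
    by (simp only: of_bit_trace[OF card] sum.distrib)
  then have "of_bit (field_trace f (x + y)) = (of_bit (field_trace f x + field_trace f y) :: 'a)"
    by (simp only: of_bit_add[OF card])
  then show ?thesis by (simp only: of_bit_inject)
qed

lemma field_trace_0 [simp]: "field_trace f 0 = 0"
  by (simp add: field_trace_def)

lemma field_trace_sum: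
  fixes g :: "'i \<Rightarrow> 'a::finite_field"
  assumes "CARD('a) = 2 ^ f"
  shows "field_trace f (sum g A) = (\<Sum>i\<in>A. field_trace f (g i))"
  by (induction A rule: infinite_finite_induct) (simp_all add: field_trace_add[OF assms])

lemma field_trace_F2_scale: "field_trace f (F2_scale c x) = c * field_trace f x"
  by (cases c) (simp_all add: F2_scale_def)

section \<open>Signs and the additive character given by the trace\<close>

definition bit_sign :: "bit \<Rightarrow> complex" where
  "bit_sign t = (if t = 0 then 1 else -1)"

lemma bit_sign_0 [simp]: "bit_sign 0 = 1"
  by (simp add: bit_sign_def)

lemma bit_sign_add: "bit_sign (s + t) = bit_sign s * bit_sign t"
  by (cases s; cases t) (simp_all add: bit_sign_def)

lemma bit_sign_sum: "bit_sign (sum g A) = (\<Prod>i\<in>A. bit_sign (g i))"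
  by (induction A rule: infinite_finite_induct) (simp_all add: bit_sign_add)

text \<open>The canonical additive character of the field, called psi in the overview.\<close>

definition trace_char :: "nat \<Rightarrow> 'a::finite_field \<Rightarrow> complex" where
  "trace_char f x = bit_sign (field_trace f x)"

lemma trace_char_0 [simp]: "trace_char f 0 = 1"
  by (simp add: trace_char_def)

lemma trace_char_add:
  fixes x y :: "'a::finite_field"
  assumes "CARD('a) = 2 ^ f"
  shows "trace_char f (x + y) = trace_char f x * trace_char f y"
  by (simp add: trace_char_def field_trace_add[OF assms] bit_sign_add)

lemma trace_char_sum:
  fixes g :: "'i \<Rightarrow> 'a::finite_field"
  assumes "CARD('a) = 2 ^ f"
  shows "trace_char f (sum g A) = (\<Prod>i\<in>A. trace_char f (g i))"
  by (simp add: trace_char_def field_trace_sum[OF assms] bit_sign_sum)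

text \<open>The chi of the overview. Since \<open>\<i>\<close> has order four, the choice of residue
  made by \<open>phi\<close> does not affect the value.\<close>

definition phi_char :: "nat \<Rightarrow> (nat \<Rightarrow> 'a::finite_field) \<Rightarrow> 'a \<Rightarrow> complex" where
  "phi_char f b x = \<i> ^ phi f b x"

lemma i_power_mod_4: "\<i> ^ (k mod 4) = \<i> ^ k"
proof -
  have "\<i> ^ k = \<i> ^ (4 * (k div 4) + k mod 4)" by simp
  also have "\<dots> = (\<i> ^ 4) ^ (k div 4) * \<i> ^ (k mod 4)"
    by (simp only: power_add power_mult)
  finally show ?thesis by simp
qed

lemma phi_char_4: "phi_char f b x ^ 4 = 1"
proof -
  have "phi_char f b x ^ 4 = (\<i> ^ 4) ^ phi f b x"
    unfolding phi_char_def by (simp only: mult.commute flip: power_mult)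
  then show ?thesis by simp
qed

text \<open>A power of \<open>\<i>\<close> with a weight as exponent splits into one factor per
  coordinate, so identities for chi can be checked coordinatewise.\<close>

lemma phi_char_combination:
  fixes b :: "nat \<Rightarrow> 'a::finite_field"
  assumes "CARD('a) = 2 ^ f" and "F2_basis f b"
  shows "phi_char f b (\<Sum>i<f. F2_scale (a i) (b i)) = (\<Prod>i<f. if a i = 0 then 1 else \<i>)"
proof -
  have "(\<Prod>i<f. if a i = 0 then 1 else \<i>) = \<i> ^ card {i. i < f \<and> a i \<noteq> 0}"
    by (simp add: prod.If_cases lessThan_def Int_def Compl_eq)
  then show ?thesis by (simp add: phi_char_def phi_sum[OF assms] i_power_mod_4)
qed

lemma F2_basis_combination:
  fixes b :: "nat \<Rightarrow> 'a::finite_field"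
  assumes card: "CARD('a) = 2 ^ f" and b: "F2_basis f b"
  obtains a where "x = (\<Sum>i<f. F2_scale (a i) (b i))"
proof -
  interpret vector_space "F2_scale :: bit \<Rightarrow> 'a \<Rightarrow> 'a"
    by (rule vector_space_F2_scale[OF card])
  have "x \<in> span (b ` {..<f})" using b by (simp add: F2_basis_def)
  then obtain u where "x = (\<Sum>v\<in>b ` {..<f}. F2_scale (u v) v)"
    by (auto simp: span_finite)
  then have "x = (\<Sum>i<f. F2_scale (u (b i)) (b i))"
    using b by (simp add: F2_basis_def sum.reindex)
  then show thesis by (rule that)
qed

text \<open>For coordinate vectors u, v over the prime field, wt(u + v) = wt(u) + wt(v) - 2k with k
  the number of common nonzero positions. The correction is (-1)^k, and trace-orthogonality
  identifies the parity of k with the trace of xy.\<close>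

lemma phi_char_add:
  fixes b :: "nat \<Rightarrow> 'a::finite_field"
  assumes card: "CARD('a) = 2 ^ f" and b: "self_complementary_basis f b"
  shows "phi_char f b (x + y) = phi_char f b x * phi_char f b y * trace_char f (x * y)"
proof -
  interpret vector_space "F2_scale :: bit \<Rightarrow> 'a \<Rightarrow> 'a"
    by (rule vector_space_F2_scale[OF card])
  have basis: "F2_basis f b" using b by (simp add: self_complementary_basis_def)
  obtain u where x: "x = (\<Sum>i<f. F2_scale (u i) (b i))"
    by (rule F2_basis_combination[OF card basis])
  obtain v where y: "y = (\<Sum>i<f. F2_scale (v i) (b i))"
    by (rule F2_basis_combination[OF card basis])
  have xy: "x + y = (\<Sum>i<f. F2_scale (u i + v i) (b i))"
    by (simp add: x y sum.distrib scale_left_distrib)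
  have scale_mult: "F2_scale c p * F2_scale d q = F2_scale (c * d) (p * q)"
    for c d and p q :: 'a
    by (cases c; cases d) (simp_all add: F2_scale_def)
  have "field_trace f (x * y) = (\<Sum>i<f. \<Sum>j<f. u i * v j * field_trace f (b i * b j))"
    by (simp add: x y sum_product field_trace_sum[OF card] scale_mult field_trace_F2_scale)
  also have "\<dots> = (\<Sum>i<f. \<Sum>j<f. if i = j then u i * v j else 0)"
    using b by (intro sum.cong refl) (auto simp: self_complementary_basis_def)
  also have "\<dots> = (\<Sum>i<f. u i * v i)"
    by (simp add: sum.delta)
  finally have trace: "trace_char f (x * y) = (\<Prod>i<f. bit_sign (u i * v i))"
    by (simp add: trace_char_def bit_sign_sum)
  \<comment> \<open>This is the claim on a single coordinate. The only case with a correction is s =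
    t = 1, where 1 + 1 = 0 is matched by \<open>\<i>\<close> squared times -1.\<close>
  have "(if s + t = 0 then 1 else \<i>) =
      (if s = 0 then 1 else \<i>) * (if t = 0 then 1 else \<i>) * bit_sign (s * t)" for s t :: bit
    by (cases s; cases t) (simp_all add: bit_sign_def)
  then have "phi_char f b (x + y) = (\<Prod>i<f. (if u i = 0 then 1 else \<i>) *
      (if v i = 0 then 1 else \<i>) * bit_sign (u i * v i))"
    unfolding xy phi_char_combination[OF card basis] by (intro prod.cong) auto
  also have "\<dots> = phi_char f b x * phi_char f b y * trace_char f (x * y)"
    unfolding trace unfolding x y phi_char_combination[OF card basis] by (simp add: prod.distrib)
  finally show ?thesis .
qed

text \<open>The functional equation gives chi(0) = chi(0)^2, and a power of \<open>\<i>\<close> is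
  nonzero.\<close>

lemma phi_char_0:
  fixes b :: "nat \<Rightarrow> 'a::finite_field"
  assumes "CARD('a) = 2 ^ f" and "self_complementary_basis f b"
  shows "phi_char f b 0 = 1"
  using phi_char_add[OF assms, of 0 0] by (simp add: phi_char_def)

text \<open>Adding \<open>c n\<close> to the partial sum costs the factor psi of that partial sum
  times \<open>c n\<close>, which is exactly the new summand j = n of the double sum.\<close>

lemma phi_char_sum:
  fixes b :: "nat \<Rightarrow> 'a::finite_field" and n :: nat
  assumes card: "CARD('a) = 2 ^ f" and b: "self_complementary_basis f b"
  shows "phi_char f b (\<Sum>i<n. c i) =
    (\<Prod>i<n. phi_char f b (c i)) * trace_char f (\<Sum>j<n. \<Sum>i<j. c i * c j)"
proof (induction n)
  case 0
  then show ?case by (simp add: phi_char_0[OF assms])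
next
  case (Suc n)
  then show ?case
    by (simp add: phi_char_add[OF assms] trace_char_add[OF card] sum_distrib_right)
qed

text \<open>Orthogonality of characters: for nonzero a, a translation by some y with character value
  -1 turns the sum into its negative.\<close>

lemma sum_trace_char:
  fixes b :: "nat \<Rightarrow> 'a::finite_field" and a :: 'a
  assumes "f \<ge> 1" and card: "CARD('a) = 2 ^ f" and b: "self_complementary_basis f b"
  shows "(\<Sum>x\<in>UNIV. trace_char f (a * x)) = (if a = 0 then 2 ^ f else 0)"
proof (cases "a = 0")
  case True
  have "(of_nat CARD('a) :: complex) = 2 ^ f" by (simp add: card)
  then show ?thesis using True by simp
next
  case False
  \<comment> \<open>As f is positive, the basis has a first element, whose square has trace 1.
    Dividing this square by a yields the required y.\<close>
  have "field_trace f (b 0 * b 0) = 1"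
    using assms by (simp add: self_complementary_basis_def)
  then have "trace_char f (a * (b 0 * b 0 / a)) = -1"
    using False by (simp add: trace_char_def bit_sign_def)
  then obtain y where y: "trace_char f (a * y) = -1" by blast
  have "(\<Sum>x\<in>UNIV. trace_char f (a * x)) = (\<Sum>x\<in>UNIV. trace_char f (a * (x + y)))"
    by (rule sum.reindex_bij_witness[of _ "\<lambda>x. x + y" "\<lambda>x. x - y"]) auto
  also have "\<dots> = - (\<Sum>x\<in>UNIV. trace_char f (a * x))"
    by (simp add: distrib_left trace_char_add[OF card] y sum_negf)
  finally show ?thesis using False by simp
qed

section \<open>Self-dual codes\<close>

text \<open>The functions are extensional because \<open>vec n\<close> forgets all values outside
  \<open>{..<n}\<close>.\<close>

lemma bij_betw_vec:
  "bij_betw (vec n) (Pi\<^sub>E {..<n} (\<lambda>_. UNIV)) (carrier_vec n)"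
proof (rule bij_betw_byWitness[where f' = "\<lambda>v. restrict (vec_index v) {..<n}"])
  show "\<forall>g\<in>Pi\<^sub>E {..<n} (\<lambda>_. UNIV). restrict (vec_index (vec n g)) {..<n} = g"
    by (auto simp: PiE_def extensional_def restrict_def fun_eq_iff)
qed (auto split: if_splits)

lemma finite_carrier_vec: "finite (carrier_vec n :: 'a::finite vec set)"
proof -
  have "finite (Pi\<^sub>E {..<n} (\<lambda>_. UNIV :: 'a set))" by (rule finite_PiE) auto
  then have "finite (vec n ` Pi\<^sub>E {..<n} (\<lambda>_. UNIV :: 'a set))" by (rule finite_imageI)
  then show ?thesis by (simp only: bij_betw_imp_surj_on[OF bij_betw_vec])
qed

text \<open>Expanding the product picks one field element per coordinate, that is, one vector. This
  serves both the character sums over the whole space and the expansion of the transformed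
  enumerator.\<close>

lemma prod_sum_carrier_vec:
  fixes g :: "nat \<Rightarrow> 'a::finite \<Rightarrow> 'b::comm_semiring_1"
  shows "(\<Prod>i<n. \<Sum>x\<in>UNIV. g i x) = (\<Sum>v\<in>carrier_vec n. \<Prod>i<n. g i (v $ i))"
proof -
  have "(\<Prod>i<n. \<Sum>x\<in>UNIV. g i x) = (\<Sum>h\<in>Pi\<^sub>E {..<n} (\<lambda>_. UNIV). \<Prod>i<n. g i (h i))"
    by (rule prod_sum_PiE) auto
  also have "\<dots> = (\<Sum>h\<in>Pi\<^sub>E {..<n} (\<lambda>_. UNIV). \<Prod>i<n. g i (vec n h $ i))"
    by simp
  also have "\<dots> = (\<Sum>v\<in>carrier_vec n. \<Prod>i<n. g i (v $ i))"
    by (rule sum.reindex_bij_betw[OF bij_betw_vec])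
  finally show ?thesis .
qed

section \<open>Closure properties of self-dual codes\<close>

lemma self_dual_subset:
  assumes "self_dual n C"
  shows "C \<subseteq> carrier_vec n"
proof -
  have "C = dual_code n C" using assms by (simp add: self_dual_def)
  then show ?thesis by (auto simp: dual_code_def)
qed

lemma self_dual_iff:
  assumes "self_dual n C"
  shows "v \<in> C \<longleftrightarrow> v \<in> carrier_vec n \<and> (\<forall>c\<in>C. c \<bullet> v = 0)"
proof -
  have "C = dual_code n C" using assms by (simp add: self_dual_def)
  then have "v \<in> C \<longleftrightarrow> v \<in> dual_code n C" by simp
  then show ?thesis by (simp add: dual_code_def)
qed

text \<open>The scalar product is additive in its second argument, so a dual is closed under
  addition.\<close>

lemma self_dual_add:
  assumes sd: "self_dual n C" and "v \<in> C" "w \<in> C"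
  shows "v + w \<in> C"
proof -
  have "v \<in> carrier_vec n" "w \<in> carrier_vec n" "\<forall>c\<in>C. c \<bullet> v = 0" "\<forall>c\<in>C. c \<bullet> w = 0"
    using assms(2,3) self_dual_iff[OF sd] by blast+
  moreover from this have "c \<bullet> (v + w) = 0" if "c \<in> C" for c
    using that self_dual_subset[OF sd] by (simp add: scalar_prod_add_distrib[of c n] subset_iff)
  ultimately show ?thesis by (simp add: self_dual_iff[OF sd, of "v + w"])
qed

lemma self_dual_smult:
  assumes sd: "self_dual n C" and "v \<in> C"
  shows "r \<cdot>\<^sub>v v \<in> C"
proof -
  have "v \<in> carrier_vec n" "\<forall>c\<in>C. c \<bullet> v = 0"
    using assms(2) self_dual_iff[OF sd] by blast+
  moreover from this have "c \<bullet> (r \<cdot>\<^sub>v v) = 0" if "c \<in> C" for c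
    using that self_dual_subset[OF sd] by (simp add: scalar_prod_smult_distrib[of c n] subset_iff)
  ultimately show ?thesis by (simp add: self_dual_iff[OF sd, of "r \<cdot>\<^sub>v v"])
qed

lemma self_dual_zero:
  assumes sd: "self_dual n C"
  shows "0\<^sub>v n \<in> C"
  using self_dual_subset[OF sd] by (auto simp: self_dual_iff[OF sd, of "0\<^sub>v n"])

text \<open>In \<open>phi_char_sum\<close> the vanishing coordinate sum makes the left side 1, and
  the vanishing sum of pairwise products makes the trace factor 1.\<close>

lemma doubly_even_prod_phi_char:
  fixes b :: "nat \<Rightarrow> 'a::finite_field" and C :: "'a vec set"
  assumes card: "CARD('a) = 2 ^ f" and b: "self_complementary_basis f b"
    and "doubly_even n C" and "c \<in> C"
  shows "(\<Prod>i<n. phi_char f b (c $ i)) = 1"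
  using phi_char_sum[OF card b, of "\<lambda>i. c $ i" n] assms(3,4)
  by (simp add: doubly_even_def phi_char_0[OF card b])

text \<open>Orthogonality on the code: the character sending c to psi(c . v) is trivial on C when v
  lies in the dual, which is C. Otherwise it is nontrivial and its sum vanishes by
  translation.\<close>

lemma sum_trace_char_code:
  fixes b :: "nat \<Rightarrow> 'a::finite_field" and C :: "'a vec set"
  assumes f: "f \<ge> 1" and card: "CARD('a) = 2 ^ f" and b: "self_complementary_basis f b"
    and sd: "self_dual n C" and v: "v \<in> carrier_vec n"
  shows "(\<Sum>c\<in>C. trace_char f (c \<bullet> v)) = (if v \<in> C then of_nat (card C) else 0)"
proof -
  have sub: "C \<subseteq> carrier_vec n" by (rule self_dual_subset[OF sd])
  show ?thesis
  proof (cases "v \<in> C")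
    case True
    then have "c \<bullet> v = 0" if "c \<in> C" for c
      using that self_dual_iff[OF sd] by blast
    then show ?thesis using True by simp
  next
    case False
    then obtain c0 where c0: "c0 \<in> C" "c0 \<bullet> v \<noteq> 0"
      using v self_dual_iff[OF sd] by blast
    \<comment> \<open>A nonzero \<open>c0 \<bullet> v\<close> alone does not make psi nontrivial
      there. If psi were 1 on all its multiples, the sum over the field would be the field size
      instead of 0.\<close>
    have "\<exists>x. trace_char f ((c0 \<bullet> v) * x) \<noteq> 1"
    proof (rule ccontr)
      assume "\<not> ?thesis"
      then have "(\<Sum>x\<in>(UNIV :: 'a set). trace_char f ((c0 \<bullet> v) * x)) = of_nat CARD('a)"
        by simp
      then show False using sum_trace_char[OF f card b, of "c0 \<bullet> v"] c0 by simp
    qed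
    then obtain x where x: "trace_char f ((c0 \<bullet> v) * x) \<noteq> 1" by blast
    let ?d = "x \<cdot>\<^sub>v c0"
    have d: "?d \<in> C" by (rule self_dual_smult[OF sd c0(1)])
    then have dc: "?d \<in> carrier_vec n" using sub by blast
    have dv: "?d \<bullet> v = (c0 \<bullet> v) * x"
      using c0(1) sub v by (auto simp: smult_scalar_prod_distrib[of _ n] mult.commute)
    have add: "c + ?d \<in> C" if "c \<in> C" for c
      by (rule self_dual_add[OF sd that d])
    \<comment> \<open>In characteristic 2 the translation by \<open>?d\<close> is an involution,
      hence its own inverse in the reindexing below.\<close>
    have twice: "c + ?d + ?d = c" if "c \<in> C" for c
    proof -
      have cc: "c \<in> carrier_vec n" using that sub by blast
      show ?thesis
        using cc dc by (intro eq_vecI) (auto simp: add.assoc double_eq_0[OF card])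
    qed
    have "(\<Sum>c\<in>C. trace_char f (c \<bullet> v)) = (\<Sum>c\<in>C. trace_char f ((c + ?d) \<bullet> v))"
      by (rule sum.reindex_bij_witness[of _ "\<lambda>c. c + ?d" "\<lambda>c. c + ?d"])
        (use add twice in auto)
    also have "\<dots> = (\<Sum>c\<in>C. trace_char f (c \<bullet> v) * trace_char f ((c0 \<bullet> v) * x))"
    proof (rule sum.cong[OF refl])
      fix c assume "c \<in> C"
      then have "c \<in> carrier_vec n" using sub by blast
      then have "(c + ?d) \<bullet> v = c \<bullet> v + (c0 \<bullet> v) * x"
        using dc v dv by (simp add: add_scalar_prod_distrib[of _ n])
      then show "trace_char f ((c + ?d) \<bullet> v) = trace_char f (c \<bullet> v) * trace_char f ((c0 \<bullet> v) * x)"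
        by (simp add: trace_char_add[OF card])
    qed
    also have "\<dots> = (\<Sum>c\<in>C. trace_char f (c \<bullet> v)) * trace_char f ((c0 \<bullet> v) * x)"
      by (simp add: sum_distrib_right)
    finally show ?thesis using x False by simp
  qed
qed

lemma trace_char_scalar_prod:
  fixes c v :: "'a::finite_field vec"
  assumes "CARD('a) = 2 ^ f" and "v \<in> carrier_vec n"
  shows "trace_char f (c \<bullet> v) = (\<Prod>i<n. trace_char f (c $ i * v $ i))"
  using assms(2) by (auto simp: scalar_prod_def trace_char_sum[OF assms(1)] atLeast0LessThan)

text \<open>Double counting of psi(c . v) over c in C and v in the whole space. Summing over c first
  leaves card C for each v in C; summing over v first leaves only the term c = 0.\<close>

lemma card_self_dual:
  fixes b :: "nat \<Rightarrow> 'a::finite_field" and C :: "'a vec set"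
  assumes f: "f \<ge> 1" and card: "CARD('a) = 2 ^ f" and b: "self_complementary_basis f b"
    and sd: "self_dual n C"
  shows "card C * card C = 2 ^ (f * n)"
proof -
  have sub: "C \<subseteq> carrier_vec n" by (rule self_dual_subset[OF sd])
  have fin: "finite C" using sub finite_carrier_vec finite_subset by blast
  have zero: "0\<^sub>v n \<in> C" by (rule self_dual_zero[OF sd])
  have inner: "(\<Sum>v\<in>carrier_vec n. trace_char f (c \<bullet> v)) =
      (if c = 0\<^sub>v n then (2 ^ f) ^ n else 0)" if "c \<in> C" for c
  proof -
    have c: "c \<in> carrier_vec n" using that sub by blast
    have "(\<Sum>v\<in>carrier_vec n. trace_char f (c \<bullet> v)) =
        (\<Sum>v\<in>carrier_vec n. \<Prod>i<n. trace_char f (c $ i * v $ i))"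
      by (intro sum.cong refl trace_char_scalar_prod[OF card])
    also have "\<dots> = (\<Prod>i<n. \<Sum>x\<in>UNIV. trace_char f (c $ i * x))"
      by (rule prod_sum_carrier_vec[symmetric])
    also have "\<dots> = (\<Prod>i<n. if c $ i = 0 then 2 ^ f else 0)"
      by (simp add: sum_trace_char[OF f card b])
    also have "\<dots> = (if c = 0\<^sub>v n then (2 ^ f) ^ n else 0)"
    proof (cases "c = 0\<^sub>v n")
      case False
      then obtain i where "i < n" "c $ i \<noteq> 0" using c by (metis eq_vecI carrier_vecD index_zero_vec)
      then show ?thesis using False by auto
    qed simp
    finally show ?thesis .
  qed
  have "(of_nat (card C * card C) :: complex) =
      (\<Sum>v\<in>carrier_vec n. if v \<in> C then of_nat (card C) else 0)"
    using sub by (simp add: sum.If_cases finite_carrier_vec Int_absorb1)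
  also have "\<dots> = (\<Sum>v\<in>carrier_vec n. \<Sum>c\<in>C. trace_char f (c \<bullet> v))"
    by (simp add: sum_trace_char_code[OF f card b sd])
  also have "\<dots> = (\<Sum>c\<in>C. \<Sum>v\<in>carrier_vec n. trace_char f (c \<bullet> v))"
    by (rule sum.swap)
  also have "\<dots> = (2 ^ f) ^ n"
    using fin zero by (simp add: inner)
  also have "\<dots> = of_nat (2 ^ (f * n))"
    by (simp add: power_mult)
  finally show ?thesis by (simp only: of_nat_eq_iff)
qed

section \<open>The generators of the Clifford-Weil group\<close>

definition h_const :: "nat \<Rightarrow> complex" where
  "h_const f = complex_of_real (2 powr (- real f / 2))"

lemma h_op_eq:
  "h_op f = alg_endo (\<lambda>a. \<Sum>b\<in>UNIV. Const (h_const f * trace_char f (a * b)) * X b)"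
  by (simp add: h_op_def h_const_def trace_char_def bit_sign_def sum_distrib_left Const_mult
      mult.assoc)

lemma d_op_eq: "d_op f b r = alg_endo (\<lambda>a. Const (phi_char f b (a * r)) * X a)"
  by (simp add: d_op_def phi_char_def)

lemma powr_half_square: "(2::real) powr (- real f / 2) * 2 powr (- real f / 2) * 2 ^ f = 1"
  by (simp flip: powr_add powr_realpow)

lemma h_const_square: "h_const f * h_const f * 2 ^ f = 1"
  using powr_half_square[of f] unfolding h_const_def
  by (metis of_real_1 of_real_mult of_real_numeral of_real_power)

text \<open>On the variables h is a Fourier transform. Applied twice it sends the index a to -a by
  orthogonality, and -a = a in characteristic 2.\<close>

lemma h_op_h_op:
  fixes b :: "nat \<Rightarrow> 'a::finite_field"
  assumes f: "f \<ge> 1" and card: "CARD('a) = 2 ^ f" and b: "self_complementary_basis f b"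
  shows "h_op f (h_op f p) = (p :: 'a cpoly)"
  unfolding h_op_eq
proof (rule alg_endo_inverse)
  fix a :: 'a
  have eq: "a + c = 0 \<longleftrightarrow> c = a" for c
    using double_eq_0[OF card, of a] by (metis add_left_cancel)
  have split: "trace_char f ((a + c) * x) = trace_char f (a * x) * trace_char f (x * c)" for c x
    by (simp only: distrib_right trace_char_add[OF card] mult.commute[of c])
  have "(\<Sum>x\<in>UNIV. Const (h_const f * trace_char f (a * x)) *
        (\<Sum>c\<in>UNIV. Const (h_const f * trace_char f (x * c)) * X c)) =
      (\<Sum>x\<in>UNIV. \<Sum>c\<in>UNIV. Const (h_const f * h_const f * trace_char f ((a + c) * x)) * X c)"
    unfolding split sum_distrib_left by (simp add: Const_mult mult_ac)
  also have "\<dots> = (\<Sum>c\<in>UNIV.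
      Const (h_const f * h_const f * (\<Sum>x\<in>UNIV. trace_char f ((a + c) * x))) * X c)"
    by (subst sum.swap) (simp add: sum_distrib_left sum_distrib_right Const_sum)
  also have "\<dots> = (\<Sum>c\<in>UNIV. if c = a then X c else 0)"
    by (intro sum.cong refl) (simp add: sum_trace_char[OF f card b] eq h_const_square)
  also have "\<dots> = X a" by simp
  finally show "alg_endo (\<lambda>a. \<Sum>b\<in>UNIV. Const (h_const f * trace_char f (a * b)) * X b)
      (\<Sum>b\<in>UNIV. Const (h_const f * trace_char f (a * b)) * X b) = X a"
    by (simp add: alg_endo_sum alg_endo_mult alg_endo_Const alg_endo_X)
qed

lemma bij_h_op:
  fixes b :: "nat \<Rightarrow> 'a::finite_field"
  assumes "f \<ge> 1" and "CARD('a) = 2 ^ f" and "self_complementary_basis f b"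
  shows "bij (h_op f :: 'a cpoly \<Rightarrow> 'a cpoly)"
  by (rule bij_betw_byWitness[where f' = "h_op f"]) (simp_all add: h_op_h_op[OF assms])

lemma bij_m_op:
  assumes "r \<noteq> 0"
  shows "bij (m_op r)"
proof -
  have inv: "m_op r (m_op s p) = p" if "r * s = 1" for r s :: 'a and p
    unfolding m_op_def
    by (rule alg_endo_inverse) (use that in \<open>simp add: alg_endo_X mult.assoc mult.commute[of s]\<close>)
  show ?thesis
    by (rule bij_betw_byWitness[where f' = "m_op (inverse r)"]) (use assms in \<open>simp_all add: inv\<close>)
qed

lemma bij_d_op: "bij (d_op f b r)"
proof -
  \<comment> \<open>The values of chi are fourth roots of unity, so their cubes are their
    inverses.\<close>
  let ?e = "alg_endo (\<lambda>a. Const (phi_char f b (a * r) ^ 3) * X a)"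
  have *: "phi_char f b x * phi_char f b x ^ 3 = 1" for x
    using phi_char_4[of f b x] by (simp add: eval_nat_numeral)
  have cancel: "Const u * (Const w * p) = p" if "u * w = 1" for u w and p :: "'a cpoly"
    using that by (simp flip: mult.assoc Const_mult)
  have "d_op f b r (?e p) = p" "?e (d_op f b r p) = p" for p
    unfolding d_op_eq
    by (auto intro!: alg_endo_inverse simp: alg_endo_mult alg_endo_Const alg_endo_X cancel *
        mult.commute[of "_ ^ 3"])
  then show ?thesis
    by (intro bij_betw_byWitness[where f' = ?e]) auto
qed

section \<open>Invariance of the complete weight enumerator under each generator\<close>

lemma m_op_cwe:
  fixes C :: "'a::finite_field vec set"
  assumes sd: "self_dual n C" and r: "r \<noteq> 0"
  shows "m_op r (cwe n C) = cwe n C"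
proof -
  have sub: "C \<subseteq> carrier_vec n" by (rule self_dual_subset[OF sd])
  have "m_op r (cwe n C) = (\<Sum>c\<in>C. \<Prod>i<n. X ((r \<cdot>\<^sub>v c) $ i))"
    unfolding m_op_def alg_endo_cwe using sub
    by (intro sum.cong prod.cong refl) (auto simp: mult.commute)
  also have "\<dots> = (\<Sum>c\<in>C. \<Prod>i<n. X (c $ i))"
    by (rule sum.reindex_bij_witness[of _ "\<lambda>c. inverse r \<cdot>\<^sub>v c" "\<lambda>c. r \<cdot>\<^sub>v c"])
      (use r self_dual_smult[OF sd] in \<open>auto simp: smult_smult_assoc\<close>)
  finally show ?thesis by (simp add: cwe_def)
qed

lemma d_op_cwe:
  fixes b :: "nat \<Rightarrow> 'a::finite_field" and C :: "'a vec set"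
  assumes card: "CARD('a) = 2 ^ f" and b: "self_complementary_basis f b"
    and de: "doubly_even n C" and sd: "self_dual n C"
  shows "d_op f b r (cwe n C) = cwe n C"
proof -
  have sub: "C \<subseteq> carrier_vec n" by (rule self_dual_subset[OF sd])
  have "(\<Prod>i<n. phi_char f b (c $ i * r)) = 1" if "c \<in> C" for c
  proof -
    \<comment> \<open>The operator evaluates chi at the coordinates of the multiple of c by r, so
      doubly-evenness is applied to that codeword.\<close>
    have "r \<cdot>\<^sub>v c \<in> C" by (rule self_dual_smult[OF sd that])
    then have "(\<Prod>i<n. phi_char f b ((r \<cdot>\<^sub>v c) $ i)) = 1"
      by (rule doubly_even_prod_phi_char[OF card b de])
    moreover have "c \<in> carrier_vec n" using that sub by blast
    ultimately show ?thesis by (simp add: mult.commute)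
  qed
  then show ?thesis
    unfolding d_op_eq alg_endo_cwe unfolding cwe_def
    by (simp add: prod.distrib flip: Const_prod)
qed

text \<open>MacWilliams: expanding the product and exchanging the sums gives each vector v the
  coefficient \<open>h_const f ^ n\<close> times a character sum over C, which is supported on C
  itself.\<close>

lemma h_op_cwe:
  fixes b :: "nat \<Rightarrow> 'a::finite_field" and C :: "'a vec set"
  assumes f: "f \<ge> 1" and card: "CARD('a) = 2 ^ f" and b: "self_complementary_basis f b"
    and sd: "self_dual n C"
  shows "h_op f (cwe n C) = cwe n C"
proof -
  have sub: "C \<subseteq> carrier_vec n" by (rule self_dual_subset[OF sd])
  define a :: real where "a = 2 powr (- real f / 2)"
  \<comment> \<open>This is the scalar remaining in front of each codeword. Its square is 1 by
    \<open>card_self_dual\<close>, and being nonnegative it equals 1.\<close>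
  define x where "x = a ^ n * real (card C)"
  have "real (card C) * real (card C) = (2 ^ f) ^ n"
    unfolding of_nat_mult[symmetric] card_self_dual[OF assms] by (simp add: power_mult)
  moreover have "x * x = (a * a) ^ n * (real (card C) * real (card C))"
    by (simp add: x_def power_mult_distrib mult_ac)
  ultimately have "x * x = (a * a * 2 ^ f) ^ n"
    by (simp only: power_mult_distrib)
  then have "x * x = 1"
    by (simp only: a_def powr_half_square power_one)
  moreover have "x \<ge> 0" by (simp add: x_def a_def)
  ultimately have "x = 1" by (simp add: square_eq_1_iff)
  moreover have "h_const f ^ n * of_nat (card C) = complex_of_real x"
    by (simp add: h_const_def x_def a_def)
  ultimately have const: "h_const f ^ n * of_nat (card C) = 1" by simp
  have "h_op f (cwe n C) =
      (\<Sum>c\<in>C. \<Sum>v\<in>carrier_vec n. \<Prod>i<n. Const (h_const f * trace_char f (c $ i * v $ i)) * X (v $ i))"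
    unfolding h_op_eq alg_endo_cwe by (simp add: prod_sum_carrier_vec)
  also have "\<dots> = (\<Sum>c\<in>C. \<Sum>v\<in>carrier_vec n.
      Const (h_const f ^ n * trace_char f (c \<bullet> v)) * (\<Prod>i<n. X (v $ i)))"
    by (intro sum.cong refl)
      (simp add: prod.distrib trace_char_scalar_prod[OF card] flip: Const_prod)
  also have "\<dots> = (\<Sum>v\<in>carrier_vec n.
      Const (h_const f ^ n * (\<Sum>c\<in>C. trace_char f (c \<bullet> v))) * (\<Prod>i<n. X (v $ i)))"
    by (subst sum.swap) (simp add: sum_distrib_left sum_distrib_right Const_sum)
  also have "\<dots> = (\<Sum>v\<in>carrier_vec n. if v \<in> C then \<Prod>i<n. X (v $ i) else 0)"
    by (intro sum.cong refl) (simp add: sum_trace_char_code[OF f card b sd] const)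
  also have "\<dots> = cwe n C"
    using sub by (simp add: sum.If_cases finite_carrier_vec Int_absorb1 cwe_def)
  finally show ?thesis .
qed

theorem theorem11:
  fixes f n :: nat
    and b :: "nat \<Rightarrow> 'a::finite_field"
    and C :: "'a vec set"
  assumes "f \<ge> 1"
    and "CARD('a) = 2 ^ f"
    and "self_complementary_basis f b"
    and "linear_code n C"
    and "doubly_even n C"
    and "self_dual n C"
  shows "cwe n C \<in> Inv (clifford_weil f b)"
proof -
  let ?S = "{h_op f} \<union> {m_op r | r. r \<noteq> 0} \<union> {d_op f b r | r. r \<noteq> 0}"
  have bij: "bij g" if "g \<in> ?S" for g
    using that bij_h_op[OF assms(1-3)] bij_m_op bij_d_op by auto
  have fixed: "g (cwe n C) = cwe n C" if "g \<in> ?S" for g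
    using that h_op_cwe[OF assms(1-3,6)] m_op_cwe[OF assms(6)] d_op_cwe[OF assms(2,3,5,6)]
    by auto
  show ?thesis
    unfolding Inv_def clifford_weil_def
    by (blast intro: generate_BijGroup_fixed[where S = ?S] bij fixed)
qed

end
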